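(* Let $K$ be a positive integer and $A \geq 1$. For every $z\in\mathbb C$ there exist complex numbers $(c_{\ell})_{0\leq \ell < K}$ such that for all real $x \geq 1$, all multiplicative functions $f:\mathbb N\to\mathbb C$ and all positive integers $n \leq x$, \[ f^{ (\ast z) }(n) = \sum_{0\leq \ell < K} c_\ell \sum_{\substack{n = n_1 n_2 \\ P^+(n_1) \leq x^{1/K}}} f^{ (\ast (z-\ell)) }(n_1)\, f^{ (\ast \ell) }(n_2). \] Moreover, $|c_\ell| \le C$ for all $|z|\le A$ and $0\le\ell<K$, with $C$ depending only on $K$ and $A$.
   Context: $P^+(n)$ denotes the largest prime factor of $n>1$, with $P^+(1)=1$. For a multiplicative function $f$ and $z\in\mathbb C$, the $z$-fold convolution $f^{(\ast z)}$ is the multiplicative function with $f^{(\ast z)}(1)=1$ and, for primes $p$ and $\nu\ge1$, \[ f^{ (\ast z) }(p^\nu) := \sum_{1\leq r\leq \nu} \binom zr \sum_{\substack{\lambda_1, \dotsc, \lambda_r \geq 1 \\ \lambda_1 + \dotsb + \lambda_r = \nu}} f(p^{\lambda_1}) \cdots f(p^{\lambda_r}), \] where $\binom zr = z(z-1)\cdots(z-r+1)/r!$. For $z=\ell\in\mathbb N$ this is the usual $\ell$-fold Dirichlet convolution (with $f^{(\ast 0)}$ the unit $n\mapsto \mathbf 1_{n=1}$). *)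

theory Defs
  imports Complex_Main "HOL-Computational_Algebra.Computational_Algebra"
begin

definition multiplicative_fun :: "(nat \<Rightarrow> complex) \<Rightarrow> bool" where
  "multiplicative_fun f \<longleftrightarrow>
     f 1 = 1 \<and> (\<forall>m n. m > 0 \<longrightarrow> n > 0 \<longrightarrow> coprime m n \<longrightarrow> f (m * n) = f m * f n)"

definition largest_prime_factor :: "nat \<Rightarrow> nat" where
  "largest_prime_factor n = (if n > 1 then Max (prime_factors n) else 1)"

definition compositions :: "nat \<Rightarrow> nat \<Rightarrow> nat list set" where
  "compositions r \<nu> = {ls. length ls = r \<and> (\<forall>l\<in>set ls. l \<ge> 1) \<and> sum_list ls = \<nu>}"

definition zfold_local :: "(nat \<Rightarrow> complex) \<Rightarrow> complex \<Rightarrow> nat \<Rightarrow> nat \<Rightarrow> complex" where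
  "zfold_local f z p \<nu> =
     (\<Sum>r=1..\<nu>. (z gchoose r) * (\<Sum>ls\<in>compositions r \<nu>. \<Prod>l\<leftarrow>ls. f (p ^ l)))"

text \<open>The multiplicative function whose value at each prime power \<open>p ^ \<nu>\<close> with \<open>\<nu> \<ge> 1\<close> is
  \<^term>\<open>zfold_local f z p \<nu>\<close>; only the values at positive integers are meaningful.\<close>

definition zfold_conv :: "(nat \<Rightarrow> complex) \<Rightarrow> complex \<Rightarrow> nat \<Rightarrow> complex" where
  "zfold_conv f z n = (\<Prod>p\<in>prime_factors n. zfold_local f z p (multiplicity p n))"

lemma finite_compositions: "finite (compositions r \<nu>)"
proof (rule finite_subset)
  show "compositions r \<nu> \<subseteq> {ls. set ls \<subseteq> {..\<nu>} \<and> length ls = r}"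
    unfolding compositions_def using member_le_sum_list by fastforce
  show "finite {ls. set ls \<subseteq> {..\<nu>} \<and> length ls = r}"
    by (rule finite_lists_length_eq) simp
qed

lemma zfold_conv_1: "zfold_conv f z 1 = 1"
  by (simp add: zfold_conv_def)

lemma zfold_conv_prime_power:
  assumes "prime p" "\<nu> \<ge> 1"
  shows "zfold_conv f z (p ^ \<nu>) = zfold_local f z p \<nu>"
  using assms by (simp add: zfold_conv_def prime_factorization_prime_power)

lemma multiplicative_zfold_conv: "multiplicative_fun (zfold_conv f z)"
  unfolding multiplicative_fun_def
proof (intro conjI allI impI)
  show "zfold_conv f z 1 = 1" by (rule zfold_conv_1)
next
  fix m n :: nat
  assume pos: "m > 0" "n > 0" and cop: "coprime m n"
  have disj: "prime_factors m \<inter> prime_factors n = {}"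
    using cop coprime_common_divisor not_prime_unit by (blast dest: in_prime_factors_imp_dvd in_prime_factors_imp_prime)
  have mult: "multiplicity p (m * n) = multiplicity p m + multiplicity p n"
    if "prime p" for p
    using that pos by (simp add: prime_elem_multiplicity_mult_distrib)
  have zero: "multiplicity p b = 0"
    if "p \<in> prime_factors a" "prime_factors a \<inter> prime_factors b = {}" "b > 0" for p a b :: nat
    using that by (auto simp: prime_factors_dvd intro!: not_dvd_imp_multiplicity_0)
  have "zfold_conv f z (m * n) =
      (\<Prod>p\<in>prime_factors m \<union> prime_factors n. zfold_local f z p (multiplicity p (m * n)))"
    using pos by (simp add: zfold_conv_def prime_factors_product)
  also have "\<dots> = (\<Prod>p\<in>prime_factors m. zfold_local f z p (multiplicity p (m * n))) *
      (\<Prod>p\<in>prime_factors n. zfold_local f z p (multiplicity p (m * n)))"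
    using disj by (intro prod.union_disjoint) auto
  also have "(\<Prod>p\<in>prime_factors m. zfold_local f z p (multiplicity p (m * n))) = zfold_conv f z m"
    unfolding zfold_conv_def using disj pos
    by (intro prod.cong refl) (simp add: mult zero in_prime_factors_imp_prime)
  also have "(\<Prod>p\<in>prime_factors n. zfold_local f z p (multiplicity p (m * n))) = zfold_conv f z n"
    unfolding zfold_conv_def using disj pos
    by (intro prod.cong refl) (simp add: mult zero[of _ n m] Int_commute in_prime_factors_imp_prime)
  finally show "zfold_conv f z (m * n) = zfold_conv f z m * zfold_conv f z n" .
qed

end

theory Submission
  imports Defs
begin

text \<open>
  The values of the \<open>z\<close>-fold convolution at the powers of \<open>p\<close> are the coefficients of
  \<open>(1 + F) ^ z\<close>, where \<open>F = f(p) X + f(p\<^sup>2) X\<^sup>2 + \<dots>\<close>. Hence the \<open>u\<close>-fold and \<open>v\<close>-fold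
  convolutions of \<open>f\<close> convolve to the \<open>(u + v)\<close>-fold one. Write \<open>y = x powr (1/K)\<close> and
  \<open>n = a b\<close> with \<open>a\<close> composed of primes at most \<open>y\<close> and \<open>b\<close> of primes exceeding \<open>y\<close>. Then the
  inner sum for \<open>l\<close> is the \<open>z\<close>-fold convolution at \<open>a\<close> times the \<open>l\<close>-fold convolution at \<open>b\<close>.
  Since \<open>b \<le> y ^ K\<close>, the number \<open>b\<close> has fewer than \<open>K\<close> prime factors with multiplicity, so the
  \<open>w\<close>-fold convolution at \<open>b\<close> is a polynomial in \<open>w\<close> of degree less than \<open>K\<close>. Lagrange
  interpolation at the nodes \<open>0, \<dots>, K - 1\<close> recovers its value at \<open>z\<close>, and the coefficients
  \<open>c\<^sub>l\<close> are the Lagrange basis polynomials evaluated at \<open>z\<close>.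
\<close>

section \<open>Generating series at a fixed prime\<close>

lemma compositions_Suc:
  "compositions (Suc r) n = (\<Union>j\<in>{1..n}. (#) j ` compositions r (n - j))"
proof (intro set_eqI iffI)
  fix ls assume ls: "ls \<in> compositions (Suc r) n"
  then obtain j ks where "ls = j # ks" by (auto simp: compositions_def length_Suc_conv)
  with ls have "j \<in> {1..n}" "ks \<in> compositions r (n - j)"
    by (auto simp: compositions_def)
  with \<open>ls = j # ks\<close> show "ls \<in> (\<Union>j\<in>{1..n}. (#) j ` compositions r (n - j))"
    by blast
qed (auto simp: compositions_def)

text \<open>The constant term is 0, so that formal composition with this series is a ring
  homomorphism and only parts \<open>l \<ge> 1\<close> contribute to its powers.\<close>

definition local_series :: "(nat \<Rightarrow> complex) \<Rightarrow> nat \<Rightarrow> complex fps" where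
  "local_series f p = Abs_fps (\<lambda>k. if k = 0 then 0 else f (p ^ k))"

text \<open>Expanding a power of the series picks one exponent from each factor; the induction
  splits off the first exponent.\<close>

lemma local_series_power_nth:
  "fps_nth (local_series f p ^ r) n = (\<Sum>ls\<in>compositions r n. \<Prod>l\<leftarrow>ls. f (p ^ l))"
proof (induction r arbitrary: n)
  case 0
  have "compositions 0 n = (if n = 0 then {[]} else {})"
    by (auto simp: compositions_def)
  then show ?case by simp
next
  case (Suc r)
  have "(\<Sum>ls\<in>compositions (Suc r) n. \<Prod>l\<leftarrow>ls. f (p ^ l))
      = (\<Sum>j\<in>{1..n}. \<Sum>ls\<in>(#) j ` compositions r (n - j). \<Prod>l\<leftarrow>ls. f (p ^ l))"
    unfolding compositions_Suc
    by (rule sum.UNION_disjoint) (auto simp: finite_compositions)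
  also have "\<dots> = (\<Sum>j\<in>{1..n}. f (p ^ j) * fps_nth (local_series f p ^ r) (n - j))"
    by (intro sum.cong refl) (simp add: sum.reindex Suc.IH sum_distrib_left)
  also have "\<dots> = (\<Sum>j\<in>{0..n}. fps_nth (local_series f p) j * fps_nth (local_series f p ^ r) (n - j))"
    by (intro sum.mono_neutral_cong_left) (auto simp: local_series_def)
  finally show ?case by (simp add: fps_mult_nth)
qed

text \<open>\<open>fps_binomial z\<close> is the formal series of (1 + X)^z.\<close>

definition zfold_series :: "(nat \<Rightarrow> complex) \<Rightarrow> complex \<Rightarrow> nat \<Rightarrow> complex fps" where
  "zfold_series f z p = fps_binomial z oo local_series f p"

lemma zfold_series_nth:
  assumes "k \<ge> 1"
  shows "fps_nth (zfold_series f z p) k = zfold_local f z p k"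
proof -
  have "fps_nth (zfold_series f z p) k
      = (\<Sum>r=0..k. (z gchoose r) * fps_nth (local_series f p ^ r) k)"
    by (simp add: zfold_series_def fps_compose_nth)
  \<comment> \<open>The term \<open>r = 0\<close> is a coefficient of the constant series 1 at index
    \<open>k \<ge> 1\<close>, hence 0.\<close>
  also have "\<dots> = (\<Sum>r=1..k. (z gchoose r) * fps_nth (local_series f p ^ r) k)"
    using assms by (intro sum.mono_neutral_right) (auto simp: not_less_eq_eq)
  finally show ?thesis by (simp add: zfold_local_def local_series_power_nth)
qed

text \<open>This is the exponent law (1 + X)^(u + v) = (1 + X)^u (1 + X)^v after
  substitution.\<close>

lemma zfold_series_add:
  "zfold_series f (u + v) p = zfold_series f u p * zfold_series f v p"
  unfolding zfold_series_def fps_binomial_add_mult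
  by (rule fps_compose_mult_distrib) (simp add: local_series_def)

lemma zfold_conv_prime_power_series:
  assumes "prime p"
  shows "zfold_conv f z (p ^ k) = fps_nth (zfold_series f z p) k"
proof (cases "k = 0")
  case True
  then show ?thesis using zfold_conv_1 by (simp add: zfold_series_def)
next
  case False
  then show ?thesis using assms by (simp add: zfold_conv_prime_power zfold_series_nth)
qed

section \<open>Multiplicative functions and Dirichlet convolution\<close>

lemma multiplicative_fun_prod_coprime:
  assumes "multiplicative_fun g" "finite P" "\<And>p. p \<in> P \<Longrightarrow> h p > 0"
    and "\<And>p q. p \<in> P \<Longrightarrow> q \<in> P \<Longrightarrow> p \<noteq> q \<Longrightarrow> coprime (h p) (h q)"
  shows "g (\<Prod>p\<in>P. h p) = (\<Prod>p\<in>P. g (h p))"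
  using assms(2-)
proof (induction P rule: finite_induct)
  case empty
  then show ?case using assms(1) by (simp add: multiplicative_fun_def)
next
  case (insert q P)
  have "coprime (h q) (\<Prod>p\<in>P. h p)"
    using insert by (intro prod_coprime_right) auto
  moreover have "(\<Prod>p\<in>P. h p) > 0" using insert by (intro prod_pos) auto
  ultimately show ?case
    using insert assms(1) by (simp add: multiplicative_fun_def)
qed

text \<open>Reduces the evaluation of the inner sums to prime powers.\<close>

lemma multiplicative_fun_prime_factors:
  assumes "multiplicative_fun g" "n > 0"
  shows "g n = (\<Prod>p\<in>prime_factors n. g (p ^ multiplicity p n))"
proof -
  have "g n = g (\<Prod>p\<in>prime_factors n. p ^ multiplicity p n)"
    using prime_factorization_nat[OF assms(2)] by simp
  also have "\<dots> = (\<Prod>p\<in>prime_factors n. g (p ^ multiplicity p n))"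
    using assms(1)
    by (rule multiplicative_fun_prod_coprime)
      (auto simp: in_prime_factors_iff prime_gt_0_nat primes_coprime)
  finally show ?thesis .
qed

definition dirichlet_conv :: "(nat \<Rightarrow> complex) \<Rightarrow> (nat \<Rightarrow> complex) \<Rightarrow> nat \<Rightarrow> complex" where
  "dirichlet_conv g h n = (\<Sum>d | d dvd n. g d * h (n div d))"

lemma bij_betw_mult_divisors:
  fixes m n :: nat
  assumes "coprime m n"
  shows "bij_betw (\<lambda>(a, b). a * b) ({a. a dvd m} \<times> {b. b dvd n}) {d. d dvd m * n}"
  unfolding bij_betw_def
proof
  \<comment> \<open>The inverse map sends \<open>d\<close> to the pair of its gcds with
    \<open>m\<close> and \<open>n\<close>.\<close>
  have gcd1: "gcd (a * b) m = a" if "a dvd m" "b dvd n" for a b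
  proof -
    have "coprime m b" using assms that coprime_divisors dvd_refl by metis
    then show ?thesis using that
      by (simp add: gcd_mult_left_right_cancel gcd_nat.absorb1)
  qed
  have gcd2: "gcd (a * b) n = b" if "a dvd m" "b dvd n" for a b
  proof -
    have "coprime n a" using assms that coprime_divisors coprime_commute dvd_refl by metis
    then show ?thesis using that
      by (simp add: gcd_mult_left_left_cancel gcd_nat.absorb1)
  qed
  show "inj_on (\<lambda>(a, b). a * b) ({a. a dvd m} \<times> {b. b dvd n})"
    by (rule inj_onI) (clarsimp, metis gcd1 gcd2)
  show "(\<lambda>(a, b). a * b) ` ({a. a dvd m} \<times> {b. b dvd n}) = {d. d dvd m * n}"
  proof (intro equalityI subsetI)
    fix d assume "d \<in> {d. d dvd m * n}"
    then obtain a b where "d = a * b" "a dvd m" "b dvd n" using division_decomp by blast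
    then show "d \<in> (\<lambda>(a, b). a * b) ` ({a. a dvd m} \<times> {b. b dvd n})" by force
  qed (auto intro: mult_dvd_mono)
qed

lemma multiplicative_dirichlet_conv:
  assumes g: "multiplicative_fun g" and h: "multiplicative_fun h"
  shows "multiplicative_fun (dirichlet_conv g h)"
  unfolding multiplicative_fun_def
proof (intro conjI allI impI)
  show "dirichlet_conv g h 1 = 1"
    using g h by (simp add: dirichlet_conv_def multiplicative_fun_def)
next
  fix m n :: nat
  assume pos: "m > 0" "n > 0" and cop: "coprime m n"
  have term_eq: "g (a * b) * h (m * n div (a * b)) = (g a * h (m div a)) * (g b * h (n div b))"
    if "a dvd m" "b dvd n" for a b
  proof -
    from that obtain a' b' where ab: "m = a * a'" "n = b * b'" by (auto elim!: dvdE)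
    have c: "coprime a b" "coprime a' b'"
      using cop ab by (auto simp: coprime_mult_left_iff coprime_mult_right_iff)
    have p: "a > 0" "a' > 0" "b > 0" "b' > 0" using pos ab by auto
    have "m * n div (a * b) = (a * b) * (a' * b') div (a * b)" unfolding ab by (simp add: ac_simps)
    also have "\<dots> = a' * b'" using p by simp
    finally have "m * n div (a * b) = a' * b'" .
    then show ?thesis using c p g h by (simp add: multiplicative_fun_def ab)
  qed
  have "dirichlet_conv g h (m * n)
      = (\<Sum>(a, b)\<in>{a. a dvd m} \<times> {b. b dvd n}. g (a * b) * h (m * n div (a * b)))"
    unfolding dirichlet_conv_def
    by (subst sum.reindex_bij_betw[OF bij_betw_mult_divisors[OF cop], symmetric])
      (simp add: case_prod_unfold)
  also have "\<dots> = (\<Sum>(a, b)\<in>{a. a dvd m} \<times> {b. b dvd n}.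
      (g a * h (m div a)) * (g b * h (n div b)))"
    by (intro sum.cong refl) (auto simp: term_eq)
  also have "\<dots> = dirichlet_conv g h m * dirichlet_conv g h n"
    by (simp add: dirichlet_conv_def sum_product sum.cartesian_product)
  finally show "dirichlet_conv g h (m * n) = dirichlet_conv g h m * dirichlet_conv g h n" .
qed

lemma dirichlet_conv_prime_power:
  assumes "prime p"
  shows "dirichlet_conv g h (p ^ k) = (\<Sum>i=0..k. g (p ^ i) * h (p ^ (k - i)))"
proof -
  have p: "p > 1" using assms by (rule prime_gt_1_nat)
  have "{d. d dvd p ^ k} = (\<lambda>i. p ^ i) ` {0..k}"
    using divides_primepow_nat[OF assms] by auto
  moreover have "inj_on (\<lambda>i. p ^ i) {0..k}" using p by (auto intro: inj_onI)
  moreover have "p ^ k div p ^ i = p ^ (k - i)" if "i \<le> k" for i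
    using p that by (simp add: power_diff)
  ultimately show ?thesis
    by (simp add: dirichlet_conv_def sum.reindex)
qed

section \<open>Restriction to smooth divisors\<close>

definition smooth_part :: "real \<Rightarrow> (nat \<Rightarrow> complex) \<Rightarrow> nat \<Rightarrow> complex" where
  "smooth_part y g n = (if \<forall>p\<in>prime_factors n. real p \<le> y then g n else 0)"

lemma multiplicative_smooth_part:
  assumes "multiplicative_fun g"
  shows "multiplicative_fun (smooth_part y g)"
  using assms unfolding multiplicative_fun_def smooth_part_def
  by (auto simp: prime_factors_product)

text \<open>The hypothesis \<open>y \<ge> 1\<close> matches the default value 1 of
  \<open>largest_prime_factor\<close> when there are no prime factors.\<close>

lemma largest_prime_factor_le_iff:
  assumes "y \<ge> 1"
  shows "real (largest_prime_factor n) \<le> y \<longleftrightarrow> (\<forall>p\<in>prime_factors n. real p \<le> y)"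
proof (cases "n > 1")
  case True
  then have "prime_factors n \<noteq> {}" by (simp add: prime_factorization_empty_iff)
  then have "Max (prime_factors n) \<in> prime_factors n" by (intro Max_in) auto
  moreover have "p \<le> Max (prime_factors n)" if "p \<in> prime_factors n" for p
    using that by (intro Max_ge) auto
  ultimately show ?thesis using True
    by (metis largest_prime_factor_def of_nat_mono order.trans)
next
  case False
  then have "n = 0 \<or> n = 1" by auto
  then show ?thesis using assms by (auto simp: largest_prime_factor_def)
qed

text \<open>Setting \<open>g\<close> to 0 at non-smooth arguments absorbs the constraint on
  \<open>n1\<close>, which turns the sum into a full convolution to which multiplicativity
  applies.\<close>

lemma sum_smooth_factorizations:
  assumes "y \<ge> 1" "n > 0"
  shows "(\<Sum>(n1, n2)\<in>{(n1, n2). n = n1 * n2 \<and> real (largest_prime_factor n1) \<le> y}. g n1 * h n2)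
    = dirichlet_conv (smooth_part y g) h n"
proof -
  let ?D = "{d. d dvd n \<and> (\<forall>p\<in>prime_factors d. real p \<le> y)}"
  have "dirichlet_conv (smooth_part y g) h n = (\<Sum>d\<in>?D. g d * h (n div d))"
    unfolding dirichlet_conv_def using assms
    by (intro sum.mono_neutral_cong_right) (auto simp: smooth_part_def)
  also have "\<dots> = (\<Sum>(n1, n2)\<in>{(n1, n2). n = n1 * n2 \<and> real (largest_prime_factor n1) \<le> y}. g n1 * h n2)"
    using assms
    by (intro sum.reindex_bij_witness[where i = fst and j = "\<lambda>d. (d, n div d)"])
      (auto simp: largest_prime_factor_le_iff)
  finally show ?thesis ..
qed

text \<open>For \<open>p\<close> at most \<open>y\<close> the truncation has no effect and exponents
  add; for larger \<open>p\<close> only the divisor 1 survives, leaving the second factor.\<close>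

lemma dirichlet_conv_smooth_zfold_prime_power:
  assumes p: "prime p"
  shows "dirichlet_conv (smooth_part y (zfold_conv f u)) (zfold_conv f v) (p ^ k)
    = (if real p \<le> y then zfold_conv f (u + v) (p ^ k) else zfold_conv f v (p ^ k))"
proof (cases "real p \<le> y")
  case True
  have "smooth_part y (zfold_conv f u) (p ^ i) = fps_nth (zfold_series f u p) i" for i
    using True p
    by (auto simp: smooth_part_def zfold_conv_prime_power_series prime_factorization_prime_power)
  then show ?thesis using True p
    by (simp add: dirichlet_conv_prime_power zfold_conv_prime_power_series zfold_series_add fps_mult_nth)
next
  case False
  have "smooth_part y (zfold_conv f u) (p ^ i) = (if i = 0 then 1 else 0)" for i
    using False p zfold_conv_1[of f u]
    by (auto simp: smooth_part_def prime_factorization_prime_power)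
  then have "dirichlet_conv (smooth_part y (zfold_conv f u)) (zfold_conv f v) (p ^ k)
      = (\<Sum>i=0..k. if i = 0 then zfold_conv f v (p ^ (k - i)) else 0)"
    using p by (simp add: dirichlet_conv_prime_power if_distrib[of "\<lambda>a. a * _"] cong: if_cong)
  then show ?thesis using False by simp
qed

text \<open>With \<open>u = z - l\<close> and \<open>v = l\<close>, the product over small primes
  becomes independent of \<open>l\<close>.\<close>

lemma sum_smooth_zfold:
  assumes "y \<ge> 1" "n > 0"
  shows "(\<Sum>(n1, n2)\<in>{(n1, n2). n = n1 * n2 \<and> real (largest_prime_factor n1) \<le> y}.
      zfold_conv f u n1 * zfold_conv f v n2)
    = (\<Prod>p\<in>{p\<in>prime_factors n. real p \<le> y}. zfold_local f (u + v) p (multiplicity p n)) *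
      (\<Prod>p\<in>{p\<in>prime_factors n. \<not> real p \<le> y}. zfold_local f v p (multiplicity p n))"
proof -
  let ?F = "dirichlet_conv (smooth_part y (zfold_conv f u)) (zfold_conv f v)"
  have "?F n = (\<Prod>p\<in>prime_factors n. ?F (p ^ multiplicity p n))"
    using assms(2)
    by (intro multiplicative_fun_prime_factors multiplicative_dirichlet_conv
        multiplicative_smooth_part multiplicative_zfold_conv)
  also have "\<dots> = (\<Prod>p\<in>prime_factors n. if real p \<le> y then zfold_local f (u + v) p (multiplicity p n)
      else zfold_local f v p (multiplicity p n))"
  proof (intro prod.cong refl)
    fix p assume p: "p \<in> prime_factors n"
    then have "prime p" "multiplicity p n \<ge> 1"
      by (auto simp: prime_factors_multiplicity)
    then show "?F (p ^ multiplicity p n) = (if real p \<le> y then zfold_local f (u + v) p (multiplicity p n)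
      else zfold_local f v p (multiplicity p n))"
      by (simp add: dirichlet_conv_smooth_zfold_prime_power zfold_conv_prime_power)
  qed
  also have "\<dots> = (\<Prod>p\<in>{p\<in>prime_factors n. real p \<le> y}. zfold_local f (u + v) p (multiplicity p n)) *
      (\<Prod>p\<in>{p\<in>prime_factors n. \<not> real p \<le> y}. zfold_local f v p (multiplicity p n))"
    by (simp add: prod.If_cases Int_def)
  finally show ?thesis using sum_smooth_factorizations[OF assms] by simp
qed

section \<open>Polynomial dependence on the exponent\<close>

lemma gchoose_poly:
  "\<exists>P::complex poly. degree P \<le> r \<and> (\<forall>z. poly P z = z gchoose r)"
proof (intro exI conjI allI)
  let ?Q = "\<Prod>i=0..<r. [:- of_nat i, 1:] :: complex poly"
  let ?P = "smult (1 / fact r) ?Q"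
  have "degree ?Q \<le> (\<Sum>i=0..<r. 1)"
    by (rule order.trans[OF degree_prod_sum_le]) auto
  then show "degree ?P \<le> r" by simp
  show "poly ?P z = z gchoose r" for z
    by (simp add: poly_prod gbinomial_prod_rev)
qed

text \<open>Only binomials with \<open>r \<le> k\<close> occur, and each has degree at most
  \<open>r\<close> in \<open>z\<close>.\<close>

lemma zfold_local_poly:
  "\<exists>P. degree P \<le> k \<and> (\<forall>z. poly P z = zfold_local f z p k)"
proof -
  obtain B :: "nat \<Rightarrow> complex poly" where
    B: "\<And>r. degree (B r) \<le> r" "\<And>r z. poly (B r) z = z gchoose r"
    using gchoose_poly by metis
  let ?P = "\<Sum>r=1..k. smult (\<Sum>ls\<in>compositions r k. \<Prod>l\<leftarrow>ls. f (p ^ l)) (B r)"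
  have "degree ?P \<le> k"
    by (intro degree_sum_le) (auto intro: order.trans[OF degree_smult_le] order.trans[OF B(1)])
  moreover have "poly ?P z = zfold_local f z p k" for z
    by (simp add: zfold_local_def poly_sum B mult.commute)
  ultimately show ?thesis by blast
qed

lemma prod_zfold_local_poly:
  assumes "finite S"
  shows "\<exists>P. degree P \<le> (\<Sum>p\<in>S. m p) \<and> (\<forall>z. poly P z = (\<Prod>p\<in>S. zfold_local f z p (m p)))"
proof -
  obtain B where B: "\<And>p. degree (B p) \<le> m p" "\<And>p z. poly (B p) z = zfold_local f z p (m p)"
    using zfold_local_poly[of "m p" f p for p] by metis
  have "degree (\<Prod>p\<in>S. B p) \<le> (\<Sum>p\<in>S. m p)"
    using B assms by (intro order.trans[OF degree_prod_sum_le]) (auto intro: sum_mono)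
  then show ?thesis using B by (intro exI[of _ "\<Prod>p\<in>S. B p"]) (simp add: poly_prod)
qed

section \<open>Lagrange interpolation at the nodes 0, ..., K - 1\<close>

definition lagrange_coeff :: "nat \<Rightarrow> complex \<Rightarrow> nat \<Rightarrow> complex" where
  "lagrange_coeff K z l = (\<Prod>j\<in>{..<K} - {l}. (z - of_nat j) / (of_nat l - of_nat j))"

text \<open>Both sides are polynomials of degree less than \<open>K\<close> agreeing at
  \<open>K\<close> distinct nodes.\<close>

lemma lagrange_interpolation:
  assumes "degree P < K"
  shows "poly P z = (\<Sum>l<K. lagrange_coeff K z l * poly P (of_nat l))"
proof -
  define L :: "nat \<Rightarrow> complex poly" where
    "L l = (\<Prod>j\<in>{..<K} - {l}. smult (1 / (of_nat l - of_nat j)) [:- of_nat j, 1:])" for l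
  have L: "poly (L l) w = lagrange_coeff K w l" for l w
    by (simp add: L_def poly_prod lagrange_coeff_def diff_divide_distrib)
  let ?Q = "\<Sum>l<K. smult (poly P (of_nat l)) (L l)"
  have degL: "degree (L l) < K" if "l < K" for l
  proof -
    have "degree (L l) \<le> (\<Sum>j\<in>{..<K} - {l}. 1)"
      unfolding L_def by (rule order.trans[OF degree_prod_sum_le]) (auto intro!: sum_mono)
    also have "\<dots> < K" using that by simp
    finally show ?thesis .
  qed
  \<comment> \<open>For \<open>l \<noteq> i\<close> the factor with \<open>j = i\<close> vanishes;
    for \<open>l = i\<close> every factor is 1.\<close>
  have delta: "lagrange_coeff K (of_nat i) l = (if l = i then 1 else 0)" if "i < K" for i l
  proof (cases "l = i")
    case False
    then show ?thesis using that by (auto simp: lagrange_coeff_def intro!: prod_zero)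
  qed (auto simp: lagrange_coeff_def intro!: prod.neutral)
  have "P = ?Q"
  proof (rule poly_eqI_degree[where A = "of_nat ` {..<K}"])
    fix x :: complex assume "x \<in> of_nat ` {..<K}"
    then obtain i where "i < K" "x = of_nat i" by auto
    then show "poly P x = poly ?Q x"
      by (simp add: poly_sum L delta if_distrib cong: if_cong)
  next
    have card: "card (of_nat ` {..<K} :: complex set) = K"
      by (simp add: card_image inj_on_def)
    then show "degree P < card (of_nat ` {..<K} :: complex set)" using assms by simp
    show "degree ?Q < card (of_nat ` {..<K} :: complex set)"
      unfolding card using assms degL
      by (intro degree_sum_less) (auto intro: le_less_trans[OF degree_smult_le])
  qed
  then have "poly P z = poly ?Q z" by simp
  then show ?thesis by (simp add: poly_sum L mult.commute)
qed

lemma cmod_lagrange_coeff_le: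
  assumes "cmod z \<le> A" "A \<ge> 1" "l < K"
  shows "cmod (lagrange_coeff K z l) \<le> (A + real K) ^ K"
proof -
  have "cmod (lagrange_coeff K z l) = (\<Prod>j\<in>{..<K} - {l}. cmod ((z - of_nat j) / (of_nat l - of_nat j)))"
    by (simp add: lagrange_coeff_def prod_norm)
  also have "\<dots> \<le> (\<Prod>j\<in>{..<K} - {l}. A + real K)"
  proof (intro prod_mono conjI)
    fix j assume j: "j \<in> {..<K} - {l}"
    \<comment> \<open>The denominator is a nonzero integer, so its modulus is at least 1.\<close>
    have "cmod (of_nat l - of_nat j) = \<bar>real_of_int (int l - int j)\<bar>"
      by (metis norm_of_int of_int_diff of_int_of_nat_eq)
    also have "\<dots> \<ge> 1" using j by auto
    finally have den: "cmod (of_nat l - of_nat j) \<ge> 1" .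
    have "cmod (z - of_nat j) \<le> cmod z + real j"
      using norm_triangle_ineq4[of z "of_nat j"] by simp
    also have "\<dots> \<le> A + real K" using j assms by auto
    finally have "cmod (z - of_nat j) \<le> A + real K" .
    moreover have "cmod (z - of_nat j) / cmod (of_nat l - of_nat j) \<le> cmod (z - of_nat j) / 1"
      using den by (intro divide_left_mono) auto
    ultimately show "cmod ((z - of_nat j) / (of_nat l - of_nat j)) \<le> A + real K"
      by (simp add: norm_divide)
  qed simp
  also have "\<dots> = (A + real K) ^ (K - 1)" using assms by simp
  also have "\<dots> \<le> (A + real K) ^ K" using assms by (intro power_increasing) auto
  finally show ?thesis .
qed

section \<open>Number of large prime factors\<close>

lemma sum_multiplicity_rough_less:
  assumes "K > 0" "x \<ge> 1" "n > 0" "real n \<le> x"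
  shows "(\<Sum>p\<in>{p\<in>prime_factors n. \<not> real p \<le> x powr (1 / real K)}. multiplicity p n) < K"
    (is "(\<Sum>p\<in>?S. _) < K")
proof (rule ccontr)
  let ?y = "x powr (1 / real K)"
  let ?d = "\<Sum>p\<in>?S. multiplicity p n"
  assume "\<not> ?d < K"
  then have d: "?d \<ge> K" by simp
  have y: "?y \<ge> 1" using assms by (simp add: ge_one_powr_ge_zero)
  \<comment> \<open>One large prime must exist to make the product comparison below strict.\<close>
  have ne: "?S \<noteq> {}" using d assms(1) by (metis sum.empty not_less)
  \<comment> \<open>At least \<open>K\<close> primes exceeding \<open>?y\<close>, counted with
    multiplicity, would have a product exceeding \<open>x\<close>, although this product divides
    \<open>n\<close>.\<close>
  have "x = ?y ^ K" using assms by (simp add: powr_powr flip: powr_realpow)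
  also have "\<dots> \<le> ?y ^ ?d" using d y by (rule power_increasing)
  also have "\<dots> = (\<Prod>p\<in>?S. ?y ^ multiplicity p n)" by (simp add: power_sum)
  also have "\<dots> < (\<Prod>p\<in>?S. real p ^ multiplicity p n)"
  proof -
    obtain q where q: "q \<in> ?S" using ne by blast
    have less: "?y ^ multiplicity p n < real p ^ multiplicity p n" if "p \<in> ?S" for p
      using that y by (intro power_strict_mono) (auto simp: prime_factors_multiplicity)
    show ?thesis
      using q y less by (intro prod_mono_strict[of q]) (auto intro: less_imp_le)
  qed
  also have "\<dots> = real (\<Prod>p\<in>?S. p ^ multiplicity p n)" by simp
  also have "\<dots> \<le> real (\<Prod>p\<in>prime_factors n. p ^ multiplicity p n)"
    by (intro of_nat_mono dvd_imp_le prod_dvd_prod_subset prod_pos)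
      (auto simp: prime_gt_0_nat in_prime_factors_iff)
  also have "\<dots> = real n" using prime_factorization_nat[OF assms(3)] by simp
  finally show False using assms(4) by simp
qed

theorem theorem3p3:
  fixes K :: nat and A :: real
  assumes "K > 0" and "A \<ge> 1"
  shows "\<exists>C::real. \<forall>z::complex. \<exists>c::nat \<Rightarrow> complex.
    (\<forall>(x::real) (f::nat \<Rightarrow> complex) (n::nat).
       x \<ge> 1 \<longrightarrow> multiplicative_fun f \<longrightarrow> n > 0 \<longrightarrow> real n \<le> x \<longrightarrow>
       zfold_conv f z n =
         (\<Sum>l<K. c l *
           (\<Sum>(n1, n2) \<in> {(n1, n2). n = n1 * n2 \<and>
                real (largest_prime_factor n1) \<le> x powr (1 / real K)}.
              zfold_conv f (z - of_nat l) n1 * zfold_conv f (of_nat l) n2))) \<and>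
    (cmod z \<le> A \<longrightarrow> (\<forall>l<K. cmod (c l) \<le> C))"
proof (intro exI[of _ "(A + real K) ^ K"] allI)
  fix z :: complex
  show "\<exists>c::nat \<Rightarrow> complex.
    (\<forall>(x::real) (f::nat \<Rightarrow> complex) (n::nat).
       x \<ge> 1 \<longrightarrow> multiplicative_fun f \<longrightarrow> n > 0 \<longrightarrow> real n \<le> x \<longrightarrow>
       zfold_conv f z n =
         (\<Sum>l<K. c l *
           (\<Sum>(n1, n2) \<in> {(n1, n2). n = n1 * n2 \<and>
                real (largest_prime_factor n1) \<le> x powr (1 / real K)}.
              zfold_conv f (z - of_nat l) n1 * zfold_conv f (of_nat l) n2))) \<and>
    (cmod z \<le> A \<longrightarrow> (\<forall>l<K. cmod (c l) \<le> (A + real K) ^ K))"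
  \<comment> \<open>The witness involves only \<open>K\<close> and \<open>z\<close>, so it serves
    all \<open>x\<close>, \<open>f\<close> and \<open>n\<close> at once.\<close>
  proof (intro exI[of _ "lagrange_coeff K z"] conjI allI impI)
    fix x :: real and f :: "nat \<Rightarrow> complex" and n :: nat
    assume x: "x \<ge> 1" and n: "n > 0" "real n \<le> x"
    define y where "y = x powr (1 / real K)"
    define S where "S = {p\<in>prime_factors n. \<not> real p \<le> y}"
    define W where "W = (\<Prod>p\<in>{p\<in>prime_factors n. real p \<le> y}. zfold_local f z p (multiplicity p n))"
    have y: "y \<ge> 1" using x by (simp add: y_def ge_one_powr_ge_zero)
    have "finite S" by (simp add: S_def)
    from prod_zfold_local_poly[OF this] obtain P where
      P: "degree P \<le> (\<Sum>p\<in>S. multiplicity p n)"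
        "\<And>w. poly P w = (\<Prod>p\<in>S. zfold_local f w p (multiplicity p n))" by metis
    have deg: "degree P < K"
      using P(1) sum_multiplicity_rough_less[OF assms(1) x n] by (simp add: S_def y_def)
    have inner: "(\<Sum>(n1, n2) \<in> {(n1, n2). n = n1 * n2 \<and> real (largest_prime_factor n1) \<le> y}.
          zfold_conv f (z - of_nat l) n1 * zfold_conv f (of_nat l) n2) = W * poly P (of_nat l)" for l
      by (simp add: sum_smooth_zfold[OF y n(1)] W_def P S_def)
    \<comment> \<open>The \<open>if\<close> with equal branches prepares the split into primes up to
      \<open>y\<close> and primes beyond \<open>y\<close>.\<close>
    have "zfold_conv f z n = (\<Prod>p\<in>prime_factors n. if real p \<le> y
        then zfold_local f z p (multiplicity p n) else zfold_local f z p (multiplicity p n))"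
      by (simp add: zfold_conv_def)
    also have "\<dots> = W * poly P z"
      unfolding W_def P S_def by (subst prod.If_cases) (simp_all add: Int_def)
    \<comment> \<open>Only the large-prime factor is interpolated; \<open>W\<close> is carried along
      as a constant.\<close>
    also have "\<dots> = (\<Sum>l<K. lagrange_coeff K z l * (W * poly P (of_nat l)))"
      by (subst lagrange_interpolation[OF deg]) (simp add: sum_distrib_left mult.left_commute)
    finally show "zfold_conv f z n =
         (\<Sum>l<K. lagrange_coeff K z l *
           (\<Sum>(n1, n2) \<in> {(n1, n2). n = n1 * n2 \<and>
                real (largest_prime_factor n1) \<le> x powr (1 / real K)}.
              zfold_conv f (z - of_nat l) n1 * zfold_conv f (of_nat l) n2))"
      using inner by (simp add: y_def)
  next
    fix l assume "cmod z \<le> A" "l < K"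
    then show "cmod (lagrange_coeff K z l) \<le> (A + real K) ^ K"
      using assms(2) by (intro cmod_lagrange_coeff_le)
  qed
qed

end
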